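(* Let $G$ be an $(n,d,\lambda)$-graph and $U$ a subset of vertices with $|U|\gg \lambda(n/d)^{3/2}$. Then there is a subset $U'\subset U$ with $|U'|=(1-o(1))|U|$ such that \[H_4(U')\ll \frac{|U'|^6d^7}{n^7}.\]
   Context: An $(n,d,\lambda)$-graph is a $d$-regular graph on $n$ vertices all of whose adjacency eigenvalues other than the largest have absolute value at most $\lambda$; $u\sim v$ denotes adjacency. For $W\subset V(G)$, $H_4(W)$ is the number of $6$-tuples $(y,z,u,v,u',x)\in W^6$ (not necessarily distinct) with $y\sim z$, $z\sim u$, $u\sim v$, $v\sim u'$, $u'\sim x$, $x\sim y$, $z\sim u'$. Asymptotic notation refers to $n\to\infty$; $f\ll g$ means $f=O(g)$ and $f\gg g$ means $f=\Omega(g)$. *)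

theory Defs
  imports
    "Graph_Theory.Pair_Digraph"
    "Jordan_Normal_Form.Char_Poly"
    "HOL-Library.Landau_Symbols"
begin

definition vertex_enum :: "'a pair_pre_digraph \<Rightarrow> nat \<Rightarrow> 'a" where
  "vertex_enum G = (SOME h. bij_betw h {..<card (pverts G)} (pverts G))"

text \<open>
  The adjacency matrix depends on the chosen enumeration of the vertices; its characteristic
  polynomial, and hence the multiset of eigenvalues below, does not.
\<close>

definition adjacency_matrix :: "'a pair_pre_digraph \<Rightarrow> real mat" where
  "adjacency_matrix G =
     mat (card (pverts G)) (card (pverts G))
       (\<lambda>(i, j). if vertex_enum G i \<rightarrow>\<^bsub>G\<^esub> vertex_enum G j then 1 else 0)"

text \<open>
  Eigenvalues with multiplicity. For a graph the adjacency matrix is real symmetric, so its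
  characteristic polynomial splits over the reals and no eigenvalue is lost.
\<close>

definition adjacency_eigenvalues :: "'a pair_pre_digraph \<Rightarrow> real multiset" where
  "adjacency_eigenvalues G = proots (char_poly (adjacency_matrix G))"

lemma in_adjacency_eigenvalues_iff:
  "\<mu> \<in># adjacency_eigenvalues G \<longleftrightarrow> eigenvalue (adjacency_matrix G) \<mu>"
proof -
  have A: "adjacency_matrix G \<in> carrier_mat (card (pverts G)) (card (pverts G))"
    by (simp add: adjacency_matrix_def)
  then have "char_poly (adjacency_matrix G) \<noteq> 0"
    using degree_monic_char_poly by force
  then show ?thesis
    by (simp add: adjacency_eigenvalues_def eigenvalue_root_char_poly[OF A])
qed

text \<open>
  Only one copy of the largest eigenvalue is exempt from the bound: if it has multiplicity at
  least two, the remaining copies must satisfy the bound as well.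
\<close>

definition ndl_graph :: "nat \<Rightarrow> nat \<Rightarrow> real \<Rightarrow> 'a pair_pre_digraph \<Rightarrow> bool" where
  "ndl_graph n d l G \<longleftrightarrow>
     pair_graph G \<and> card (pverts G) = n \<and>
     (\<forall>v \<in> pverts G. out_degree G v = d) \<and>
     (\<forall>\<mu> \<in># adjacency_eigenvalues G - {# Max (set_mset (adjacency_eigenvalues G)) #}. \<bar>\<mu>\<bar> \<le> l)"

definition H4 :: "'a pair_pre_digraph \<Rightarrow> 'a set \<Rightarrow> nat" where
  "H4 G W = card {(y, z, u, v, u', x).
     y \<in> W \<and> z \<in> W \<and> u \<in> W \<and> v \<in> W \<and> u' \<in> W \<and> x \<in> W \<and>
     y \<rightarrow>\<^bsub>G\<^esub> z \<and> z \<rightarrow>\<^bsub>G\<^esub> u \<and> u \<rightarrow>\<^bsub>G\<^esub> v \<and> v \<rightarrow>\<^bsub>G\<^esub> u' \<and> u' \<rightarrow>\<^bsub>G\<^esub> x \<and> x \<rightarrow>\<^bsub>G\<^esub> y \<and> z \<rightarrow>\<^bsub>G\<^esub> u'}"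

end

theory Submission
  imports Defs "HOL-Analysis.Function_Topology" "HOL-Analysis.Convex"
begin

text \<open>
  It suffices to take \<open>U' = U\<close>. Write \<open>q = d / n\<close>, \<open>m = |U|\<close>, let \<open>A\<close> be the adjacency matrix restricted
  to \<open>U\<close> and \<open>M = A - q J\<close> with \<open>J\<close> the all-ones matrix. A copy of \<open>H\<^sub>4\<close> consists of two paths of length
  three with the same adjacent endpoints, so \<open>H\<^sub>4(U)\<close> is the sum of the squared entries of \<open>A\<^sup>3\<close> over the
  edges. Expanding \<open>A\<^sup>3 = (q J + M)\<^sup>3\<close> gives the expected constant \<open>q\<^sup>3 m\<^sup>2\<close>, terms in the degree deviations
  \<open>g = M 1\<close> and in \<open>M g\<close>, and \<open>M\<^sup>3\<close>. Since \<open>M\<close> has operator norm at most \<open>\<lambda>\<close>, these have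
  \<open>\<ell>\<^sup>2\<close> norms bounded by powers of \<open>\<lambda>\<close>; in particular the squared entries of \<open>M\<^sup>3\<close>, summed over all
  pairs and not only over the edges, are at most \<open>\<lambda>\<^sup>4\<close> times the squared Frobenius norm of \<open>M\<close>, which is
  \<open>O(q m\<^sup>2)\<close>. The hypothesis \<open>\<lambda>\<^sup>2 = O(q\<^sup>3 m\<^sup>2)\<close> makes every contribution \<open>O(q\<^sup>7 m\<^sup>6)\<close>.
\<close>

section \<open>Weighted counts of paths of length three\<close>

lemma square_sum8_le:
  fixes a b c d e f g h :: real
  shows "(a + b + c + d + e + f + g + h)\<^sup>2
    \<le> 8 * (a\<^sup>2 + b\<^sup>2 + c\<^sup>2 + d\<^sup>2 + e\<^sup>2 + f\<^sup>2 + g\<^sup>2 + h\<^sup>2)"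
proof -
  have two: "(x + y)\<^sup>2 \<le> 2 * x\<^sup>2 + 2 * y\<^sup>2" for x y :: real
    using zero_le_power2[of "x - y"] by (simp add: power2_sum power2_diff)
  show ?thesis
    using two[of "a + b + c + d" "e + f + g + h"] two[of "a + b" "c + d"] two[of "e + f" "g + h"]
      two[of a b] two[of c d] two[of e f] two[of g h]
    by (simp add: add.assoc)
qed

text \<open>Substituting \<open>a = q + M\<close> in all three factors gives eight products. Each
  factor \<open>q\<close> removes the dependence on two indices, and summing \<open>M\<close> over
  an index thus freed yields \<open>g\<close>.\<close>

lemma cube_decomposition:
  fixes a M :: "'a \<Rightarrow> 'a \<Rightarrow> real"
  assumes g: "\<And>v. g v = (\<Sum>w\<in>W. M v w)"
    and M: "\<And>v w. M v w = a v w - q"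
    and sym: "\<And>v w. a v w = a w v"
    and m: "m = real (card W)"
  shows "(\<Sum>u\<in>W. \<Sum>v\<in>W. a z u * a u v * a v t) =
    q ^ 3 * m\<^sup>2 + q\<^sup>2 * m * g z + q\<^sup>2 * (\<Sum>w\<in>W. g w) + q * (\<Sum>w\<in>W. M z w * g w)
    + q\<^sup>2 * m * g t + q * g z * g t + q * (\<Sum>w\<in>W. M t w * g w)
    + (\<Sum>u\<in>W. M z u * (\<Sum>v\<in>W. M u v * M v t))"
proof -
  have a: "a v w = q + M v w" for v w by (simp add: M)
  have Msym: "M v w = M w v" for v w by (simp add: M sym)
  have g': "(\<Sum>w\<in>W. M w v) = g v" for v unfolding g by (intro sum.cong refl Msym)
  \<comment> \<open>Contracting over \<open>u\<close> first turns the column sum of \<open>M\<close>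
    into \<open>g v\<close>, by symmetry.\<close>
  have s1: "(\<Sum>u\<in>W. \<Sum>v\<in>W. M u v * M v t) = (\<Sum>w\<in>W. M t w * g w)"
  proof -
    have "(\<Sum>u\<in>W. \<Sum>v\<in>W. M u v * M v t) = (\<Sum>v\<in>W. (\<Sum>u\<in>W. M u v) * M v t)"
      by (subst sum.swap) (simp add: sum_distrib_right)
    also have "\<dots> = (\<Sum>v\<in>W. M t v * g v)"
      unfolding g' Msym[of _ t] by (simp add: mult.commute)
    finally show ?thesis .
  qed
  have "(\<Sum>u\<in>W. \<Sum>v\<in>W. a z u * a u v * a v t) =
    (\<Sum>u\<in>W. \<Sum>v\<in>W. q ^ 3 + q\<^sup>2 * M z u + q\<^sup>2 * M u v + q * (M z u * M u v)
      + q\<^sup>2 * M v t + q * (M z u * M v t) + q * (M u v * M v t) + M z u * (M u v * M v t))"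
    by (intro sum.cong refl) (simp add: a algebra_simps power2_eq_square power3_eq_cube)
  also have "\<dots> = q ^ 3 * m\<^sup>2 + q\<^sup>2 * m * g z + q\<^sup>2 * (\<Sum>w\<in>W. g w) + q * (\<Sum>w\<in>W. M z w * g w)
    + q\<^sup>2 * m * g t + q * g z * g t + q * (\<Sum>u\<in>W. \<Sum>v\<in>W. M u v * M v t)
    + (\<Sum>u\<in>W. M z u * (\<Sum>v\<in>W. M u v * M v t))"
    by (simp add: sum.distrib g g' m power2_eq_square algebra_simps flip: sum_distrib_left sum_distrib_right)
      (simp add: sum_distrib_left mult_ac)
  finally show ?thesis unfolding s1 .
qed

text \<open>The constant is \<open>88 = 8 * 11\<close>: the factor 8 comes from squaring a sum of
  eight terms, whose contributions are 2, six times 1, and 3, each times \<open>K ^ 3 * B\<close>.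
  Since \<open>1 \<le> K\<close>, the lower powers of \<open>K\<close> are absorbed into
  \<open>K ^ 3\<close>.\<close>

lemma sum_edges_square_cube_le:
  fixes a :: "'a \<Rightarrow> 'a \<Rightarrow> real"
  assumes a01: "\<And>v w. a v w = 0 \<or> a v w = 1"
    and sym: "\<And>v w. a v w = a w v"
    and q: "0 \<le> q" "q \<le> 1"
    and m: "m = real (card W)"
    and op: "\<And>x. (\<Sum>v\<in>W. (\<Sum>w\<in>W. (a v w - q) * x w)\<^sup>2) \<le> l\<^sup>2 * (\<Sum>w\<in>W. (x w)\<^sup>2)"
    and K: "1 \<le> K" "l\<^sup>2 \<le> K * q ^ 3 * m\<^sup>2"
  shows "(\<Sum>z\<in>W. \<Sum>t\<in>W. a z t * (\<Sum>u\<in>W. \<Sum>v\<in>W. a z u * a u v * a v t)\<^sup>2)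
    \<le> 88 * K ^ 3 * (q ^ 7 * m ^ 6)"
proof -
  define M where "M v w = a v w - q" for v w
  define g where "g v = (\<Sum>w\<in>W. M v w)" for v
  define h where "h v = (\<Sum>w\<in>W. M v w * g w)" for v
  define c where "c z t = (\<Sum>u\<in>W. M z u * (\<Sum>v\<in>W. M u v * M v t))" for z t
  define G where "G = (\<Sum>w\<in>W. g w)"
  define B where "B = q ^ 7 * m ^ 6"
  have m0: "m \<ge> 0" and B0: "B \<ge> 0" using q m by (auto simp: B_def)
  have a: "0 \<le> a v w" "a v w \<le> 1" for v w using a01[of v w] by auto
  have K0: "0 \<le> K" and K1: "K \<le> K ^ 3" "K\<^sup>2 \<le> K ^ 3" "1 \<le> K ^ 3"
    using K power_increasing[of 1 3 K] power_increasing[of 2 3 K] by auto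
  have opM: "(\<Sum>v\<in>W. (\<Sum>w\<in>W. M v w * x w)\<^sup>2) \<le> l\<^sup>2 * (\<Sum>w\<in>W. (x w)\<^sup>2)" for x
    using op unfolding M_def .
  have l4: "l\<^sup>2 * l\<^sup>2 \<le> K\<^sup>2 * q ^ 6 * m ^ 4"
  proof -
    have "l\<^sup>2 * l\<^sup>2 \<le> (K * q ^ 3 * m\<^sup>2) * (K * q ^ 3 * m\<^sup>2)"
      using K K0 q by (intro mult_mono) auto
    also have "\<dots> = K\<^sup>2 * q ^ 6 * m ^ 4" by (simp add: power2_eq_square power_mult_distrib eval_nat_numeral)
    finally show ?thesis .
  qed
  \<comment> \<open>\<open>g\<close> is \<open>M\<close> applied to the constant function 1, and
    \<open>h\<close> below is \<open>M\<close> applied to \<open>g\<close>; each application costs a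
    factor \<open>l\<^sup>2\<close>.\<close>
  have g2: "(\<Sum>w\<in>W. (g w)\<^sup>2) \<le> K * q ^ 3 * m ^ 3"
  proof -
    have "(\<Sum>w\<in>W. (g w)\<^sup>2) \<le> l\<^sup>2 * m"
      using opM[of "\<lambda>_. 1"] by (simp add: g_def m)
    also have "\<dots> \<le> K * q ^ 3 * m\<^sup>2 * m" using K m0 by (intro mult_right_mono) auto
    finally show ?thesis by (simp add: eval_nat_numeral mult_ac)
  qed
  have g2_0: "0 \<le> (\<Sum>w\<in>W. (g w)\<^sup>2)" by (simp add: sum_nonneg)
  have h2: "(\<Sum>w\<in>W. (h w)\<^sup>2) \<le> K\<^sup>2 * q ^ 6 * m ^ 5"
  proof -
    have "(\<Sum>w\<in>W. (h w)\<^sup>2) \<le> l\<^sup>2 * (\<Sum>w\<in>W. (g w)\<^sup>2)"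
      unfolding h_def by (rule opM)
    also have "\<dots> \<le> (K * q ^ 3 * m\<^sup>2) * (K * q ^ 3 * m ^ 3)"
      using K K0 q g2 g2_0 by (intro mult_mono) auto
    finally show ?thesis by (simp add: eval_nat_numeral mult_ac)
  qed
  \<comment> \<open>Cauchy-Schwarz against the constant function.\<close>
  have G2: "G\<^sup>2 \<le> K * q ^ 3 * m ^ 4"
  proof -
    have "G\<^sup>2 \<le> m * (\<Sum>w\<in>W. (g w)\<^sup>2)" using sum_squared_le_sum_of_squares[of g W] by (simp add: G_def m mult.commute)
    also have "\<dots> \<le> m * (K * q ^ 3 * m ^ 3)" using g2 m0 by (rule mult_left_mono)
    finally show ?thesis by (simp add: eval_nat_numeral mult_ac)
  qed
  \<comment> \<open>A single power of \<open>q\<close> suffices, since this error only has to match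
    the main term \<open>q * m\<^sup>2\<close> of the edge count. It follows from \<open>G2\<close>
    by \<open>q ^ 3 \<le> q\<^sup>2\<close> and \<open>K \<le> K\<^sup>2\<close>.\<close>
  have G1: "G \<le> K * q * m\<^sup>2"
  proof (rule power2_le_imp_le)
    have "K * q ^ 3 \<le> K\<^sup>2 * q\<^sup>2"
      using K q by (intro mult_mono self_le_power power_decreasing) auto
    then have "K * q ^ 3 * m ^ 4 \<le> K\<^sup>2 * q\<^sup>2 * m ^ 4" by (intro mult_right_mono) auto
    then show "G\<^sup>2 \<le> (K * q * m\<^sup>2)\<^sup>2" using G2 by (simp add: power_mult_distrib)
  qed (use K q in auto)
  have e: "(\<Sum>z\<in>W. \<Sum>t\<in>W. a z t) \<le> (1 + K) * q * m\<^sup>2"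
  proof -
    have "G = (\<Sum>z\<in>W. \<Sum>t\<in>W. a z t) - q * m\<^sup>2"
      by (simp add: G_def g_def M_def sum_subtractf m power2_eq_square)
    then show ?thesis using G1 by (simp add: algebra_simps)
  qed
  have M2: "(\<Sum>z\<in>W. \<Sum>t\<in>W. (M z t)\<^sup>2) \<le> 3 * K * q * m\<^sup>2"
  proof -
    \<comment> \<open>Here the values 0 and 1 of \<open>a\<close> matter: the Frobenius norm is
      thereby controlled by the edge count, which saves a factor \<open>q\<close> over the trivial
      bound.\<close>
    have "(M z t)\<^sup>2 \<le> a z t + q" for z t
    proof -
      have "q * q \<le> 1 * q" using q by (intro mult_right_mono) auto
      then show ?thesis
        using a01[of z t] q by (auto simp: M_def power2_eq_square algebra_simps)
    qed
    then have "(\<Sum>z\<in>W. \<Sum>t\<in>W. (M z t)\<^sup>2) \<le> (\<Sum>z\<in>W. \<Sum>t\<in>W. a z t + q)"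
      by (intro sum_mono)
    also have "\<dots> = (\<Sum>z\<in>W. \<Sum>t\<in>W. a z t) + q * m\<^sup>2"
      by (simp add: sum.distrib m power2_eq_square)
    also have "\<dots> \<le> (2 + K) * q * m\<^sup>2" using e by (simp add: algebra_simps)
    also have "\<dots> \<le> (3 * K) * q * m\<^sup>2" using K q by (intro mult_right_mono) auto
    finally show ?thesis .
  qed
  have c2: "(\<Sum>z\<in>W. \<Sum>t\<in>W. (c z t)\<^sup>2) \<le> 3 * K ^ 3 * B"
  proof -
    \<comment> \<open>Column \<open>t\<close> of \<open>c\<close> is \<open>M\<close> applied twice
      to column \<open>t\<close> of \<open>M\<close>.\<close>
    have col: "(\<Sum>z\<in>W. (c z t)\<^sup>2) \<le> l\<^sup>2 * l\<^sup>2 * (\<Sum>v\<in>W. (M v t)\<^sup>2)" for t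
    proof -
      have "(\<Sum>z\<in>W. (c z t)\<^sup>2) \<le> l\<^sup>2 * (\<Sum>u\<in>W. (\<Sum>v\<in>W. M u v * M v t)\<^sup>2)"
        unfolding c_def by (rule opM)
      also have "\<dots> \<le> l\<^sup>2 * (l\<^sup>2 * (\<Sum>v\<in>W. (M v t)\<^sup>2))"
        by (intro mult_left_mono opM) auto
      finally show ?thesis by (simp add: mult_ac)
    qed
    have "(\<Sum>z\<in>W. \<Sum>t\<in>W. (c z t)\<^sup>2) \<le> (\<Sum>t\<in>W. l\<^sup>2 * l\<^sup>2 * (\<Sum>v\<in>W. (M v t)\<^sup>2))"
      by (subst sum.swap) (intro sum_mono col)
    also have "\<dots> = l\<^sup>2 * l\<^sup>2 * (\<Sum>z\<in>W. \<Sum>t\<in>W. (M z t)\<^sup>2)"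
      by (subst sum.swap) (simp add: sum_distrib_left)
    also have "\<dots> \<le> (K\<^sup>2 * q ^ 6 * m ^ 4) * (3 * K * q * m\<^sup>2)"
      by (rule mult_mono[OF l4 M2]) (auto intro!: sum_nonneg)
    finally show ?thesis by (simp add: B_def eval_nat_numeral mult_ac)
  qed
  \<comment> \<open>Dropping the edge weight is affordable: the squared norms of \<open>g\<close>
    and \<open>h\<close> already carry enough powers of \<open>q\<close>.\<close>
  have edge_sum: "(\<Sum>z\<in>W. \<Sum>t\<in>W. a z t * (f z)\<^sup>2) \<le> m * (\<Sum>z\<in>W. (f z)\<^sup>2)"
    "(\<Sum>z\<in>W. \<Sum>t\<in>W. a z t * (f t)\<^sup>2) \<le> m * (\<Sum>z\<in>W. (f z)\<^sup>2)" for f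
  proof -
    have "(\<Sum>z\<in>W. \<Sum>t\<in>W. a z t * (f z)\<^sup>2) \<le> (\<Sum>z\<in>W. \<Sum>t\<in>W. (f z)\<^sup>2)"
      using a by (intro sum_mono mult_left_le_one_le) auto
    then show "(\<Sum>z\<in>W. \<Sum>t\<in>W. a z t * (f z)\<^sup>2) \<le> m * (\<Sum>z\<in>W. (f z)\<^sup>2)"
      by (simp add: m sum_distrib_left)
    have "(\<Sum>z\<in>W. \<Sum>t\<in>W. a z t * (f t)\<^sup>2) \<le> (\<Sum>z\<in>W. \<Sum>t\<in>W. (f t)\<^sup>2)"
      using a by (intro sum_mono mult_left_le_one_le) auto
    then show "(\<Sum>z\<in>W. \<Sum>t\<in>W. a z t * (f t)\<^sup>2) \<le> m * (\<Sum>z\<in>W. (f z)\<^sup>2)"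
      by (simp add: m)
  qed
  \<comment> \<open>The terms with \<open>h\<close> and with \<open>g z * g t\<close> gain one more
    power of \<open>q\<close> than is required.\<close>
  have q8: "q ^ 8 * m ^ 6 \<le> B" 
    unfolding B_def using q by (intro mult_right_mono power_decreasing) auto
  \<comment> \<open>The only one of the eight terms where the edge density must be kept: the
    constant squared gives \<open>q ^ 6 * m ^ 4\<close>, and the edge count supplies the seventh
    power of \<open>q\<close>.\<close>
  have t1: "(\<Sum>z\<in>W. \<Sum>t\<in>W. a z t) * (q ^ 3 * m\<^sup>2)\<^sup>2 \<le> 2 * K ^ 3 * B"
  proof -
    have "(\<Sum>z\<in>W. \<Sum>t\<in>W. a z t) * (q ^ 3 * m\<^sup>2)\<^sup>2 \<le> (1 + K) * q * m\<^sup>2 * (q ^ 3 * m\<^sup>2)\<^sup>2"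
      using e by (intro mult_right_mono) auto
    also have "\<dots> = (1 + K) * B" by (simp add: B_def eval_nat_numeral mult_ac)
    also have "\<dots> \<le> 2 * K ^ 3 * B" using K1 B0 by (intro mult_right_mono) auto
    finally show ?thesis .
  qed
  have t2: "q ^ 4 * m\<^sup>2 * (m * (\<Sum>w\<in>W. (g w)\<^sup>2)) \<le> K ^ 3 * B"
  proof -
    have "q ^ 4 * m\<^sup>2 * (m * (\<Sum>w\<in>W. (g w)\<^sup>2)) \<le> q ^ 4 * m\<^sup>2 * (m * (K * q ^ 3 * m ^ 3))"
      using g2 m0 by (intro mult_left_mono) auto
    also have "\<dots> = K * B" by (simp add: B_def eval_nat_numeral mult_ac)
    also have "\<dots> \<le> K ^ 3 * B" using K1 B0 by (intro mult_right_mono) auto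
    finally show ?thesis .
  qed
  have t3: "q ^ 4 * G\<^sup>2 * (\<Sum>z\<in>W. \<Sum>t\<in>W. a z t) \<le> K ^ 3 * B"
  proof -
    have "(\<Sum>z\<in>W. \<Sum>t\<in>W. a z t) \<le> (\<Sum>z\<in>W. \<Sum>t\<in>W. 1)"
      using a by (intro sum_mono)
    then have "(\<Sum>z\<in>W. \<Sum>t\<in>W. a z t) \<le> m\<^sup>2" by (simp add: m power2_eq_square)
    then have "q ^ 4 * G\<^sup>2 * (\<Sum>z\<in>W. \<Sum>t\<in>W. a z t) \<le> q ^ 4 * (K * q ^ 3 * m ^ 4) * m\<^sup>2"
      using G2 q K a by (intro mult_mono sum_nonneg) auto
    also have "\<dots> = K * B" by (simp add: B_def eval_nat_numeral mult_ac)
    also have "\<dots> \<le> K ^ 3 * B" using K1 B0 by (intro mult_right_mono) auto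
    finally show ?thesis .
  qed
  have t4: "q\<^sup>2 * (m * (\<Sum>w\<in>W. (h w)\<^sup>2)) \<le> K ^ 3 * B"
  proof -
    have "q\<^sup>2 * (m * (\<Sum>w\<in>W. (h w)\<^sup>2)) \<le> q\<^sup>2 * (m * (K\<^sup>2 * q ^ 6 * m ^ 5))"
      using h2 m0 by (intro mult_left_mono) auto
    also have "\<dots> = K\<^sup>2 * (q ^ 8 * m ^ 6)" by (simp add: eval_nat_numeral mult_ac)
    also have "\<dots> \<le> K ^ 3 * B" using K0 K1 q8 q m0 by (intro mult_mono) auto
    finally show ?thesis .
  qed
  have t6: "(\<Sum>z\<in>W. \<Sum>t\<in>W. a z t * (q * g z * g t)\<^sup>2) \<le> K ^ 3 * B"
  proof -
    have "(\<Sum>z\<in>W. \<Sum>t\<in>W. a z t * (q * g z * g t)\<^sup>2) \<le> (\<Sum>z\<in>W. \<Sum>t\<in>W. (q * g z * g t)\<^sup>2)"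
      using a by (intro sum_mono mult_left_le_one_le) auto
    also have "\<dots> = q\<^sup>2 * ((\<Sum>w\<in>W. (g w)\<^sup>2) * (\<Sum>w\<in>W. (g w)\<^sup>2))"
      by (simp add: sum_product power_mult_distrib sum_distrib_left mult_ac)
    also have "\<dots> \<le> q\<^sup>2 * ((K * q ^ 3 * m ^ 3) * (K * q ^ 3 * m ^ 3))"
      using g2 g2_0 K q m0 by (intro mult_left_mono mult_mono) auto
    also have "\<dots> = K\<^sup>2 * (q ^ 8 * m ^ 6)" by (simp add: eval_nat_numeral mult_ac)
    also have "\<dots> \<le> K ^ 3 * B" using K0 K1 q8 q m0 by (intro mult_mono) auto
    finally show ?thesis .
  qed
  have t8: "(\<Sum>z\<in>W. \<Sum>t\<in>W. a z t * (c z t)\<^sup>2) \<le> 3 * K ^ 3 * B"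
  proof -
    have "(\<Sum>z\<in>W. \<Sum>t\<in>W. a z t * (c z t)\<^sup>2) \<le> (\<Sum>z\<in>W. \<Sum>t\<in>W. (c z t)\<^sup>2)"
      using a by (intro sum_mono mult_left_le_one_le) auto
    then show ?thesis using c2 by linarith
  qed
  have pointwise: "a z t * (\<Sum>u\<in>W. \<Sum>v\<in>W. a z u * a u v * a v t)\<^sup>2 \<le>
      8 * (a z t * (q ^ 3 * m\<^sup>2)\<^sup>2 + q ^ 4 * m\<^sup>2 * (a z t * (g z)\<^sup>2) + q ^ 4 * G\<^sup>2 * a z t
        + q\<^sup>2 * (a z t * (h z)\<^sup>2) + q ^ 4 * m\<^sup>2 * (a z t * (g t)\<^sup>2) + a z t * (q * g z * g t)\<^sup>2
        + q\<^sup>2 * (a z t * (h t)\<^sup>2) + a z t * (c z t)\<^sup>2)" for z t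
  proof -
    have "(\<Sum>u\<in>W. \<Sum>v\<in>W. a z u * a u v * a v t) = q ^ 3 * m\<^sup>2 + q\<^sup>2 * m * g z + q\<^sup>2 * G + q * h z
        + q\<^sup>2 * m * g t + q * g z * g t + q * h t + c z t"
      unfolding h_def G_def c_def by (rule cube_decomposition) (auto simp: g_def M_def sym m)
    then have "a z t * (\<Sum>u\<in>W. \<Sum>v\<in>W. a z u * a u v * a v t)\<^sup>2 \<le>
        a z t * (8 * ((q ^ 3 * m\<^sup>2)\<^sup>2 + (q\<^sup>2 * m * g z)\<^sup>2 + (q\<^sup>2 * G)\<^sup>2 + (q * h z)\<^sup>2
        + (q\<^sup>2 * m * g t)\<^sup>2 + (q * g z * g t)\<^sup>2 + (q * h t)\<^sup>2 + (c z t)\<^sup>2))"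
      using a square_sum8_le by (intro mult_left_mono) auto
    also have "(q\<^sup>2 * m * g z)\<^sup>2 = q ^ 4 * m\<^sup>2 * (g z)\<^sup>2" by (simp add: power_mult_distrib)
    also have "(q\<^sup>2 * m * g t)\<^sup>2 = q ^ 4 * m\<^sup>2 * (g t)\<^sup>2" by (simp add: power_mult_distrib)
    also have "(q\<^sup>2 * G)\<^sup>2 = q ^ 4 * G\<^sup>2" by (simp add: power_mult_distrib)
    also have "(q * h z)\<^sup>2 = q\<^sup>2 * (h z)\<^sup>2" by (simp add: power_mult_distrib)
    also have "(q * h t)\<^sup>2 = q\<^sup>2 * (h t)\<^sup>2" by (simp add: power_mult_distrib)
    finally show ?thesis by (simp add: algebra_simps)
  qed
  have "(\<Sum>z\<in>W. \<Sum>t\<in>W. a z t * (\<Sum>u\<in>W. \<Sum>v\<in>W. a z u * a u v * a v t)\<^sup>2) \<le>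
      8 * ((\<Sum>z\<in>W. \<Sum>t\<in>W. a z t) * (q ^ 3 * m\<^sup>2)\<^sup>2
        + q ^ 4 * m\<^sup>2 * (\<Sum>z\<in>W. \<Sum>t\<in>W. a z t * (g z)\<^sup>2)
        + q ^ 4 * G\<^sup>2 * (\<Sum>z\<in>W. \<Sum>t\<in>W. a z t)
        + q\<^sup>2 * (\<Sum>z\<in>W. \<Sum>t\<in>W. a z t * (h z)\<^sup>2)
        + q ^ 4 * m\<^sup>2 * (\<Sum>z\<in>W. \<Sum>t\<in>W. a z t * (g t)\<^sup>2)
        + (\<Sum>z\<in>W. \<Sum>t\<in>W. a z t * (q * g z * g t)\<^sup>2)
        + q\<^sup>2 * (\<Sum>z\<in>W. \<Sum>t\<in>W. a z t * (h t)\<^sup>2)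
        + (\<Sum>z\<in>W. \<Sum>t\<in>W. a z t * (c z t)\<^sup>2))"
    by (rule order_trans[OF sum_mono[OF sum_mono[OF pointwise]]])
      (simp add: sum.distrib flip: sum_distrib_left sum_distrib_right)
  \<comment> \<open>The terms in \<open>g t\<close> and \<open>h t\<close> have the same bounds as
    those in \<open>g z\<close> and \<open>h z\<close>, so \<open>t2\<close> and \<open>t4\<close>
    serve twice.\<close>
  also have "\<dots> \<le> 8 * (2 * K ^ 3 * B + K ^ 3 * B + K ^ 3 * B + K ^ 3 * B + K ^ 3 * B
      + K ^ 3 * B + K ^ 3 * B + 3 * K ^ 3 * B)"
    using q
    by (intro mult_left_mono add_mono t1 t3 t6 t8
        order_trans[OF mult_left_mono[OF edge_sum(1)] t2]
        order_trans[OF mult_left_mono[OF edge_sum(2)] t2]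
        order_trans[OF mult_left_mono[OF edge_sum(1)] t4]
        order_trans[OF mult_left_mono[OF edge_sum(2)] t4]) auto
  also have "\<dots> = 88 * K ^ 3 * B" by simp
  finally show ?thesis unfolding B_def .
qed

section \<open>Symmetric kernels and eigenvectors\<close>

text \<open>The first-order condition at an extremum, without derivatives: near 0 a nonzero linear
  term would dominate, and \<open>t = - \<beta> / c\<close> with
  \<open>c > \<bar>\<alpha>\<bar>\<close> is small enough to give a negative value.\<close>

lemma linear_term_zero_of_nonneg_quadratic:
  fixes \<alpha> \<beta> :: real
  assumes "\<And>t. 0 \<le> \<alpha> * t\<^sup>2 + \<beta> * t"
  shows "\<beta> = 0"
proof (rule ccontr)
  assume "\<beta> \<noteq> 0"
  define c where "c = \<bar>\<alpha>\<bar> + 1"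
  have c: "c > 0" "\<alpha> < c" unfolding c_def by auto
  have "\<alpha> * (- \<beta> / c)\<^sup>2 + \<beta> * (- \<beta> / c) = (\<beta> / c)\<^sup>2 * (\<alpha> - c)"
    using c by (simp add: field_simps power2_eq_square)
  moreover have "\<dots> < 0"
    using c \<open>\<beta> \<noteq> 0\<close> by (intro mult_pos_neg) auto
  ultimately show False using assms[of "- \<beta> / c"] by linarith
qed

text \<open>Requiring \<open>x\<close> to vanish off \<open>V\<close> places the set inside a
  product of intervals and singletons, compact by Tychonoff; the two equations cut out a closed
  subset.\<close>

lemma compact_mean_zero_sphere:
  fixes V :: "'a set"
  assumes fin: "finite V"
  shows "compact {x :: 'a \<Rightarrow> real. (\<forall>v. v \<notin> V \<longrightarrow> x v = 0) \<and> (\<Sum>v\<in>V. x v) = 0 \<and> (\<Sum>v\<in>V. (x v)\<^sup>2) = 1}"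
    (is "compact ?S")
proof -
  let ?B = "PiE UNIV (\<lambda>v. if v \<in> V then {-1..1} else {0 :: real})"
  have "compactin (product_topology (\<lambda>_. euclidean) UNIV) ?B"
    by (subst compactin_PiE) auto
  then have "compact ?B"
    by (simp add: euclidean_product_topology)
  moreover have "closed {x :: 'a \<Rightarrow> real. (\<Sum>v\<in>V. x v) = 0 \<and> (\<Sum>v\<in>V. (x v)\<^sup>2) = 1}"
    by (intro closed_Collect_conj closed_Collect_eq continuous_intros continuous_on_product_coordinates)
  moreover have "?S = ?B \<inter> {x. (\<Sum>v\<in>V. x v) = 0 \<and> (\<Sum>v\<in>V. (x v)\<^sup>2) = 1}"
  proof -
    have "x v \<in> {-1..1}" if "(\<Sum>v\<in>V. (x v)\<^sup>2) = 1" "v \<in> V" for x :: "'a \<Rightarrow> real" and v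
    proof -
      have "(x v)\<^sup>2 \<le> 1"
        using member_le_sum[of v V "\<lambda>v. (x v)\<^sup>2"] that fin by simp
      then show ?thesis by (simp add: abs_square_le_1 abs_le_iff)
    qed
    then show ?thesis by (auto simp: PiE_iff split: if_splits)
  qed
  ultimately show ?thesis by (simp add: compact_Int_closed)
qed

text \<open>
  A maximiser \<open>z\<close> of the norm of \<open>T z\<close> on the unit sphere satisfies
  \<open>T (T z) = \<mu>\<^sup>2 z\<close>, so \<open>T z + \<mu> z\<close> is an eigenvector for \<open>\<mu>\<close>, unless it vanishes and
  \<open>z\<close> is one for \<open>- \<mu>\<close>.
\<close>

lemma extremal_mean_zero_eigenvector:
  fixes k :: "'a \<Rightarrow> 'a \<Rightarrow> real"
  assumes fin: "finite V"
    and sym: "\<And>v w. v \<in> V \<Longrightarrow> w \<in> V \<Longrightarrow> k v w = k w v"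
    and row: "\<And>v. v \<in> V \<Longrightarrow> (\<Sum>w\<in>V. k v w) = D"
    and x0: "(\<Sum>v\<in>V. x0 v) = 0" "v0 \<in> V" "x0 v0 \<noteq> 0"
  obtains \<mu> y where "(\<Sum>v\<in>V. y v) = 0" "\<exists>v\<in>V. y v \<noteq> 0"
    "\<forall>v\<in>V. (\<Sum>w\<in>V. k v w * y w) = \<mu> * y v"
    "(\<Sum>v\<in>V. (\<Sum>w\<in>V. k v w * x0 w)\<^sup>2) \<le> \<mu>\<^sup>2 * (\<Sum>v\<in>V. (x0 v)\<^sup>2)"
proof -
  define T where "T x v = (\<Sum>w\<in>V. k v w * x w)" for x v
  define ip where "ip x y = (\<Sum>v\<in>V. x v * y v)" for x y :: "'a \<Rightarrow> real"
  define S where "S = {x :: 'a \<Rightarrow> real. (\<forall>v. v \<notin> V \<longrightarrow> x v = 0) \<and> (\<Sum>v\<in>V. x v) = 0 \<and> (\<Sum>v\<in>V. (x v)\<^sup>2) = 1}"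
  have N_eq: "ip x x = (\<Sum>v\<in>V. (x v)\<^sup>2)" for x
    by (simp add: ip_def power2_eq_square)
  have N_nonneg: "ip x x \<ge> 0" for x
    by (simp add: N_eq sum_nonneg)
  have N_zero: "x v = 0" if "ip x x = 0" "v \<in> V" for x v
    using that fin by (simp add: N_eq sum_nonneg_eq_0_iff)
  have T_lin: "T (\<lambda>v. a * x v + b * y v) = (\<lambda>v. a * T x v + b * T y v)" for a b x y
    by (rule ext) (simp add: T_def algebra_simps sum.distrib sum_distrib_left)
  have ip_comm: "ip x y = ip y x" for x y by (simp add: ip_def mult.commute)
  have ip_lin: "ip (\<lambda>v. a * x v + b * y v) z = a * ip x z + b * ip y z" for a b x y z
    by (simp add: ip_def algebra_simps sum.distrib sum_distrib_left)
  have ip_lin': "ip z (\<lambda>v. a * x v + b * y v) = a * ip z x + b * ip z y" for a b x y z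
    using ip_lin ip_comm by metis
  have T_self: "ip (T x) y = ip x (T y)" for x y
  proof -
    have "ip (T x) y = (\<Sum>v\<in>V. \<Sum>w\<in>V. k v w * x w * y v)"
      by (simp add: ip_def T_def sum_distrib_right)
    also have "\<dots> = (\<Sum>w\<in>V. \<Sum>v\<in>V. k w v * x w * y v)"
      by (subst sum.swap) (intro sum.cong refl, simp add: sym)
    also have "\<dots> = ip x (T y)"
      by (simp add: ip_def T_def sum_distrib_left mult_ac)
    finally show ?thesis .
  qed
  \<comment> \<open>Constants are eigenfunctions by the row-sum condition, so the self-adjoint
    \<open>T\<close> preserves their orthogonal complement.\<close>
  have T_mean: "(\<Sum>v\<in>V. T x v) = 0" if "(\<Sum>v\<in>V. x v) = 0" for x
  proof -
    have "(\<Sum>v\<in>V. T x v) = ip (T x) (\<lambda>_. 1)" by (simp add: ip_def)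
    also have "\<dots> = (\<Sum>v\<in>V. x v * D)"
      unfolding T_self by (simp add: ip_def T_def row)
    also have "\<dots> = 0" using that by (simp flip: sum_distrib_right)
    finally show ?thesis .
  qed
  have normalise: "\<exists>x'\<in>S. ip (T x) (T x) = ip x x * ip (T x') (T x')"
    if "(\<Sum>v\<in>V. x v) = 0" "ip x x \<noteq> 0" for x
  proof -
    define c where "c = sqrt (ip x x)"
    have c: "c \<noteq> 0" "c\<^sup>2 = ip x x" using that N_nonneg[of x] by (auto simp: c_def)
    define x' where "x' v = (if v \<in> V then x v / c else 0)" for v
    have "(\<Sum>v\<in>V. x' v) = 0"
      using that by (simp add: x'_def flip: sum_divide_distrib)
    moreover have "(\<Sum>v\<in>V. (x' v)\<^sup>2) = 1"
      using that by (simp add: x'_def power_divide c N_eq flip: sum_divide_distrib)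
    ultimately have "x' \<in> S" by (simp add: S_def x'_def)
    moreover have "T x = (\<lambda>v. c * T x' v)"
      using c by (intro ext) (simp add: T_def x'_def sum_distrib_left)
    then have "ip (T x) (T x) = c\<^sup>2 * ip (T x') (T x')"
      by (simp add: ip_def sum_distrib_left power2_eq_square mult_ac)
    ultimately show ?thesis using c by auto
  qed
  have "ip x0 x0 \<noteq> 0" using N_zero[of x0 v0] x0 by auto
  then have "S \<noteq> {}" using normalise[of x0] x0 by blast
  moreover have "compact S"
    unfolding S_def by (rule compact_mean_zero_sphere[OF fin])
  moreover have "continuous_on S (\<lambda>x. ip (T x) (T x))"
    unfolding ip_def T_def
    by (intro continuous_intros continuous_on_subset[OF continuous_on_product_coordinates subset_UNIV])
  ultimately obtain z where z: "z \<in> S" and zmax: "\<And>x. x \<in> S \<Longrightarrow> ip (T x) (T x) \<le> ip (T z) (T z)"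
    using continuous_attains_sup[of S "\<lambda>x. ip (T x) (T x)"] by blast
  define \<rho> where "\<rho> = ip (T z) (T z)"
  have z1: "ip z z = 1" "(\<Sum>v\<in>V. z v) = 0" using z by (auto simp: S_def N_eq)
  have bound: "ip (T x) (T x) \<le> \<rho> * ip x x" if mean: "(\<Sum>v\<in>V. x v) = 0" for x
  proof (cases "ip x x = 0")
    case True
    then have "T x = (\<lambda>_. 0)"
      by (intro ext) (auto simp: T_def intro!: sum.neutral dest: N_zero)
    then show ?thesis using True by (simp add: ip_def)
  next
    case False
    then obtain x' where "x' \<in> S" "ip (T x) (T x) = ip x x * ip (T x') (T x')"
      using normalise mean by blast
    then show ?thesis
      using zmax N_nonneg[of x] by (simp add: \<rho>_def mult.commute mult_left_mono)
  qed
  \<comment> \<open>Half the gradient at \<open>z\<close> of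
    \<open>\<rho> * ip y y - ip (T y) (T y)\<close>. This form is nonnegative on mean-zero functions
    and vanishes at \<open>z\<close>; moving from \<open>z\<close> along \<open>r\<close> gives the
    linear coefficient \<open>2 * ip r r\<close>, which must therefore be zero.\<close>
  define r where "r = (\<lambda>v. \<rho> * z v + (- 1) * T (T z) v)"
  have r0: "(\<Sum>v\<in>V. r v) = 0"
    using z1 T_mean by (simp add: r_def sum_subtractf flip: sum_distrib_left)
  have "2 * ip r r = 0"
  proof (rule linear_term_zero_of_nonneg_quadratic)
    fix t
    let ?y = "\<lambda>v. 1 * z v + t * r v"
    have "(\<Sum>v\<in>V. ?y v) = 0" using z1 r0 by (simp add: sum.distrib flip: sum_distrib_left)
    from bound[OF this]
    have "0 \<le> \<rho> * ip ?y ?y - ip (T ?y) (T ?y)" by simp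
    also have "\<dots> = (\<rho> * ip r r - ip (T r) (T r)) * t\<^sup>2 + 2 * (\<rho> * ip z r - ip (T (T z)) r) * t"
      unfolding T_lin ip_lin ip_lin'
      using z1 T_self[of "T z" r] ip_comm[of r z] ip_comm[of "T r" "T z"] \<rho>_def
      by (simp add: algebra_simps power2_eq_square)
    also have "\<rho> * ip z r - ip (T (T z)) r = ip r r"
      using ip_lin[of \<rho> z "- 1" "T (T z)" r] by (simp add: r_def)
    finally show "0 \<le> (\<rho> * ip r r - ip (T r) (T r)) * t\<^sup>2 + 2 * ip r r * t" .
  qed
  then have TT: "T (T z) v = \<rho> * z v" if "v \<in> V" for v
    using N_zero[of r v] that by (simp add: r_def)
  define \<mu> where "\<mu> = sqrt \<rho>"
  have \<mu>: "\<mu>\<^sup>2 = \<rho>" using N_nonneg by (simp add: \<mu>_def \<rho>_def)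
  have fin_bound: "(\<Sum>v\<in>V. (\<Sum>w\<in>V. k v w * x0 w)\<^sup>2) \<le> \<rho> * (\<Sum>v\<in>V. (x0 v)\<^sup>2)"
    using bound[OF x0(1)] by (simp add: N_eq T_def)
  obtain vz where vz: "vz \<in> V" "z vz \<noteq> 0"
    using z1 by (cases "\<forall>v\<in>V. z v = 0") (auto simp: ip_def)
  show ?thesis
  proof (cases "\<exists>v\<in>V. T z v + \<mu> * z v \<noteq> 0")
    case True
    have lin: "T (\<lambda>v. 1 * T z v + \<mu> * z v) = (\<lambda>v. 1 * T (T z) v + \<mu> * T z v)"
      by (rule T_lin)
    show ?thesis
    proof (rule that[of "\<lambda>v. T z v + \<mu> * z v" \<mu>])
      show "(\<Sum>v\<in>V. T z v + \<mu> * z v) = 0"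
        using z1 T_mean by (simp add: sum.distrib flip: sum_distrib_left)
      show "\<forall>v\<in>V. (\<Sum>w\<in>V. k v w * (T z w + \<mu> * z w)) = \<mu> * (T z v + \<mu> * z v)"
        using fun_cong[OF lin] TT \<mu>
        by (simp add: T_def[of "\<lambda>v. T z v + \<mu> * z v"] algebra_simps power2_eq_square)
    qed (use True fin_bound \<mu> in auto)
  next
    case False
    then have "T z v = - \<mu> * z v" if "v \<in> V" for v using that by (simp add: eq_neg_iff_add_eq_0)
    then show ?thesis
      using z1 vz fin_bound \<mu> by (intro that[of z "- \<mu>"]) (auto simp: T_def)
  qed
qed

text \<open>Compare both sides of the eigenvalue equation at a point where the absolute value of
  \<open>y\<close> is largest.\<close>

lemma abs_eigenvalue_le_row_sum:
  fixes k :: "'a \<Rightarrow> 'a \<Rightarrow> real"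
  assumes fin: "finite V"
    and nonneg: "\<And>v w. v \<in> V \<Longrightarrow> w \<in> V \<Longrightarrow> 0 \<le> k v w"
    and row: "\<And>v. v \<in> V \<Longrightarrow> (\<Sum>w\<in>V. k v w) = D"
    and ev: "\<And>v. v \<in> V \<Longrightarrow> (\<Sum>w\<in>V. k v w * y w) = \<mu> * y v"
    and nz: "\<exists>v\<in>V. y v \<noteq> 0"
  shows "\<bar>\<mu>\<bar> \<le> D"
proof -
  define b where "b = Max ((\<lambda>v. \<bar>y v\<bar>) ` V)"
  have "b \<in> (\<lambda>v. \<bar>y v\<bar>) ` V" unfolding b_def using fin nz by (intro Max_in) auto
  then obtain v where v: "v \<in> V" "\<bar>y v\<bar> = b" by auto
  have le: "\<bar>y w\<bar> \<le> b" if "w \<in> V" for w unfolding b_def using fin that by simp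
  have "b > 0" using nz le by force
  have "\<bar>\<mu>\<bar> * b = \<bar>\<Sum>w\<in>V. k v w * y w\<bar>" using ev v by (simp add: abs_mult)
  also have "\<dots> \<le> (\<Sum>w\<in>V. \<bar>k v w * y w\<bar>)" by (rule sum_abs)
  also have "\<dots> \<le> (\<Sum>w\<in>V. k v w * b)"
    using nonneg le v by (intro sum_mono) (auto simp: abs_mult intro!: mult_left_mono)
  also have "\<dots> = D * b" using row v by (simp flip: sum_distrib_right)
  finally show ?thesis using \<open>b > 0\<close> by simp
qed

section \<open>Independent eigenvectors and double roots of the characteristic polynomial\<close>

text \<open>With \<open>v\<close> lifted to constant polynomials, \<open>X * v - A * v\<close>
  becomes \<open>(X - e) * v\<close>. The row-wise form matches an entry of a matrix
  product.\<close>

lemma char_poly_matrix_mult_eigenvector: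
  fixes A :: "'a :: comm_ring_1 mat"
  assumes A: "A \<in> carrier_mat n n" and v: "v \<in> carrier_vec n" and ev: "A *\<^sub>v v = e \<cdot>\<^sub>v v"
    and r: "r < n"
  shows "(\<Sum>s = 0..<n. char_poly_matrix A $$ (r, s) * [:v $ s:]) = [:v $ r:] * [:- e, 1:]"
proof -
  have "(\<Sum>s = 0..<n. A $$ (r, s) * v $ s) = (A *\<^sub>v v) $ r"
    using A v r by (auto simp: scalar_prod_def intro!: sum.cong)
  also have "\<dots> = e * v $ r" using ev v r by simp
  finally have Av: "(\<Sum>s = 0..<n. A $$ (r, s) * v $ s) = e * v $ r" .
  have "(\<Sum>s = 0..<n. char_poly_matrix A $$ (r, s) * [:v $ s:])
      = (\<Sum>s = 0..<n. (if r = s then [:0, v $ s:] else 0) + [:- (A $$ (r, s) * v $ s):])"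
    using A r by (intro sum.cong) (auto simp: char_poly_matrix_def)
  also have "\<dots> = [:0, v $ r:] + (\<Sum>s = 0..<n. [:- (A $$ (r, s) * v $ s):])"
    using r by (simp add: sum.distrib)
  also have "(\<Sum>s = 0..<n. [:- (A $$ (r, s) * v $ s):]) = [:- (\<Sum>s = 0..<n. A $$ (r, s) * v $ s):]"
    by (simp add: poly_eq_iff coeff_sum coeff_pCons sum_negf split: nat.splits)
  finally show ?thesis by (simp only: Av) (simp add: mult.commute)
qed

text \<open>
  Replacing two columns of the identity matrix by the eigenvectors gives an invertible matrix, and
  multiplying the characteristic matrix by it makes two of the columns divisible by \<^term>\<open>[:- e, 1:]\<close>.
\<close>

lemma char_poly_double_root:
  fixes A :: "'a :: field mat"
  assumes A: "A \<in> carrier_mat n n"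
    and x: "x \<in> carrier_vec n" "A *\<^sub>v x = e \<cdot>\<^sub>v x"
    and y: "y \<in> carrier_vec n" "A *\<^sub>v y = e \<cdot>\<^sub>v y"
    and ij: "i < n" "j < n" "x $ i * y $ j \<noteq> x $ j * y $ i"
  shows "[:- e, 1:] ^ 2 dvd char_poly A"
proof -
  define C where "C = char_poly_matrix A"
  define P where "P = mat n n (\<lambda>(r, c). if c = i then x $ r else if c = j then y $ r
    else if r = c then 1 else 0)"
  define P' where "P' = map_mat (\<lambda>a. [:a:]) P"
  \<comment> \<open>\<open>R\<close> is what remains of the product \<open>C * P'\<close> once the
    linear factor, collected in \<open>D\<close>, is taken out of columns \<open>i\<close> and
    \<open>j\<close>.\<close>
  define R where "R = mat n n (\<lambda>(r, c). if c = i then [:x $ r:] else if c = j then [:y $ r:]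
    else C $$ (r, c))"
  define D where "D = mat n n (\<lambda>(r, c). if r = c then if c = i \<or> c = j then [:- e, 1:] else 1 else 0)"
  have dims: "C \<in> carrier_mat n n" "P \<in> carrier_mat n n" "P' \<in> carrier_mat n n"
    "R \<in> carrier_mat n n" "D \<in> carrier_mat n n"
    using A by (auto simp: C_def P_def P'_def R_def D_def)
  have "i \<noteq> j" using ij by auto
  have "C * P' = R * D"
  proof (rule eq_matI)
    fix r c assume "r < dim_row (R * D)" "c < dim_col (R * D)"
    then have r: "r < n" and c: "c < n" using dims by auto
    have "(R * D) $$ (r, c) = (\<Sum>s = 0..<n. R $$ (r, s) * D $$ (s, c))"
      using dims r c by (auto simp: scalar_prod_def)
    also have "\<dots> = (\<Sum>s = 0..<n. if s = c then R $$ (r, c) * D $$ (c, c) else 0)"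
      using c by (intro sum.cong) (auto simp: D_def)
    also have "\<dots> = R $$ (r, c) * D $$ (c, c)" using c by simp
    finally have RD: "(R * D) $$ (r, c) = R $$ (r, c) * D $$ (c, c)" .
    have CP: "(C * P') $$ (r, c) = (\<Sum>s = 0..<n. C $$ (r, s) * [:P $$ (s, c):])"
      using dims r c by (auto simp: scalar_prod_def P'_def)
    show "(C * P') $$ (r, c) = (R * D) $$ (r, c)"
    proof (cases "c = i \<or> c = j")
      case True
      then show ?thesis
      proof
        assume "c = i"
        then have "(C * P') $$ (r, c) = (\<Sum>s = 0..<n. C $$ (r, s) * [:x $ s:])"
          unfolding CP using c by (intro sum.cong) (auto simp: P_def)
        then show ?thesis
          using char_poly_matrix_mult_eigenvector[OF A x r] RD r c \<open>c = i\<close>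
          by (simp add: C_def R_def D_def)
      next
        assume "c = j"
        then have "(C * P') $$ (r, c) = (\<Sum>s = 0..<n. C $$ (r, s) * [:y $ s:])"
          unfolding CP using c \<open>i \<noteq> j\<close> by (intro sum.cong) (auto simp: P_def)
        then show ?thesis
          using char_poly_matrix_mult_eigenvector[OF A y r] RD r c \<open>c = j\<close> \<open>i \<noteq> j\<close>
          by (simp add: C_def R_def D_def)
      qed
    next
      case False
      have "(C * P') $$ (r, c) = (\<Sum>s = 0..<n. if s = c then C $$ (r, c) else 0)"
        unfolding CP using c False by (intro sum.cong) (auto simp: P_def)
      then show ?thesis using False RD r c by (simp add: R_def D_def)
    qed
  qed (use dims in auto)
  then have "det C * det P' = det R * det D"
    using dims det_mult by metis
  moreover have "det D = [:- e, 1:] ^ 2"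
  proof -
    have "det D = (\<Prod>c = 0..<n. D $$ (c, c))"
      using det_upper_triangular[of D n] dims
      by (simp add: prod_list_diag_prod D_def upper_triangular_def)
    also have "\<dots> = (\<Prod>c = 0..<n. if c \<in> {i, j} then [:- e, 1:] else 1)"
      by (intro prod.cong) (auto simp: D_def)
    also have "\<dots> = (\<Prod>c\<in>{0..<n} \<inter> {i, j}. [:- e, 1:])"
      by (rule prod.inter_restrict[symmetric]) simp
    also have "{0..<n} \<inter> {i, j} = {i, j}" using ij by auto
    finally show ?thesis using \<open>i \<noteq> j\<close> by (simp add: power2_eq_square)
  qed
  \<comment> \<open>For a kernel vector, rows \<open>i\<close> and \<open>j\<close> form a 2 by 2
    system in \<open>v $ i\<close> and \<open>v $ j\<close> whose determinant is nonzero by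
    hypothesis; the other rows then force the remaining entries to vanish.\<close>
  moreover have "det P \<noteq> 0"
  proof
    assume "det P = 0"
    then obtain v where v: "v \<in> carrier_vec n" "v \<noteq> 0\<^sub>v n" "P *\<^sub>v v = 0\<^sub>v n"
      using det_0_iff_vec_prod_zero_field[OF dims(2)] by blast
    have row: "x $ r * v $ i + y $ r * v $ j + (if r \<noteq> i \<and> r \<noteq> j then v $ r else 0) = 0"
      if r: "r < n" for r
    proof -
      have "(P *\<^sub>v v) $ r = (\<Sum>s = 0..<n. P $$ (r, s) * v $ s)"
        using dims(2) v(1) r by (auto simp: scalar_prod_def intro!: sum.cong)
      then have "0 = (\<Sum>s = 0..<n. P $$ (r, s) * v $ s)"
        unfolding v(3) using r by simp
      also have "\<dots> = (\<Sum>s = 0..<n. (if s = i then x $ r * v $ i else 0)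
          + (if s = j then y $ r * v $ j else 0)
          + (if s = r then if r \<noteq> i \<and> r \<noteq> j then v $ r else 0 else 0))"
        using r \<open>i \<noteq> j\<close> by (intro sum.cong) (auto simp: P_def)
      also have "\<dots> = x $ r * v $ i + y $ r * v $ j + (if r \<noteq> i \<and> r \<noteq> j then v $ r else 0)"
        using r ij by (simp only: sum.distrib sum.delta finite_atLeastLessThan) simp
      finally show ?thesis by simp
    qed
    have ri: "x $ i * v $ i + y $ i * v $ j = 0" and rj: "x $ j * v $ i + y $ j * v $ j = 0"
      using row[of i] row[of j] ij by auto
    have "(x $ i * y $ j - x $ j * y $ i) * v $ j
        = x $ i * (x $ j * v $ i + y $ j * v $ j) - x $ j * (x $ i * v $ i + y $ i * v $ j)"
      by (simp add: algebra_simps)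
    then have vj: "v $ j = 0" using ri rj ij by simp
    have "(x $ i * y $ j - x $ j * y $ i) * v $ i
        = y $ j * (x $ i * v $ i + y $ i * v $ j) - y $ i * (x $ j * v $ i + y $ j * v $ j)"
      by (simp add: algebra_simps)
    then have vi: "v $ i = 0" using ri rj ij by simp
    have "v $ r = 0" if "r < n" for r
      using row[OF that] vi vj by (auto split: if_splits)
    then have "v = 0\<^sub>v n" using v by (intro eq_vecI) auto
    then show False using v by simp
  qed
  moreover have "det P' = [:det P:]"
  proof -
    interpret coeff_lift_hom: comm_ring_hom "\<lambda>a :: 'a. [:a:]"
      by unfold_locales simp_all
    show ?thesis unfolding P'_def by (rule coeff_lift_hom.hom_det)
  qed
  \<comment> \<open>\<open>det P'\<close> is a nonzero constant polynomial, hence a unit that does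
    not affect divisibility.\<close>
  ultimately have eq: "Polynomial.smult (det P) (char_poly A) = det R * [:- e, 1:] ^ 2"
    by (simp add: char_poly_def C_def mult.commute)
  have "[:- e, 1:] ^ 2 dvd Polynomial.smult (det P) (char_poly A)" unfolding eq by simp
  then show ?thesis using \<open>det P \<noteq> 0\<close> by (simp add: dvd_smult_iff)
qed

section \<open>Spectral bounds for regular graphs\<close>

definition adj :: "'a pair_pre_digraph \<Rightarrow> 'a \<Rightarrow> 'a \<Rightarrow> real" where
  "adj G v w = of_bool (v \<rightarrow>\<^bsub>G\<^esub> w)"

section \<open>From eigenfunctions on vertices to eigenvectors of the adjacency matrix\<close>

lemma bij_betw_vertex_enum:
  assumes "finite (pverts G)"
  shows "bij_betw (vertex_enum G) {..<card (pverts G)} (pverts G)"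
  unfolding vertex_enum_def
  using ex_bij_betw_nat_finite[OF assms] unfolding atLeast0LessThan by (rule someI_ex)

lemma sum_vertex_enum:
  assumes "finite (pverts G)"
  shows "(\<Sum>i<card (pverts G). f (vertex_enum G i)) = (\<Sum>v\<in>pverts G. f v)"
  by (rule sum.reindex_bij_betw[OF bij_betw_vertex_enum[OF assms]])

lemma adjacency_matrix_mult_vec:
  assumes "v \<in> carrier_vec (card (pverts G))" "i < card (pverts G)"
  shows "(adjacency_matrix G *\<^sub>v v) $ i =
    (\<Sum>j<card (pverts G). adj G (vertex_enum G i) (vertex_enum G j) * v $ j)"
  using assms by (auto simp: adjacency_matrix_def adj_def of_bool_def scalar_prod_def atLeast0LessThan intro!: sum.cong)

lemma adjacency_matrix_eigenfunction:
  assumes "finite (pverts G)"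
    and "\<And>v. v \<in> pverts G \<Longrightarrow> (\<Sum>w\<in>pverts G. adj G v w * y w) = \<mu> * y v"
  shows "adjacency_matrix G *\<^sub>v vec (card (pverts G)) (\<lambda>i. y (vertex_enum G i))
    = \<mu> \<cdot>\<^sub>v vec (card (pverts G)) (\<lambda>i. y (vertex_enum G i))"
proof (rule eq_vecI)
  fix i assume "i < dim_vec (\<mu> \<cdot>\<^sub>v vec (card (pverts G)) (\<lambda>i. y (vertex_enum G i)))"
  then have i: "i < card (pverts G)" by simp
  then have "vertex_enum G i \<in> pverts G"
    using bij_betw_vertex_enum[OF assms(1)] by (auto simp: bij_betw_def)
  moreover have "(adjacency_matrix G *\<^sub>v vec (card (pverts G)) (\<lambda>i. y (vertex_enum G i))) $ i
    = (\<Sum>j<card (pverts G). adj G (vertex_enum G i) (vertex_enum G j) * y (vertex_enum G j))"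
    using i by (subst adjacency_matrix_mult_vec) auto
  ultimately show "(adjacency_matrix G *\<^sub>v vec (card (pverts G)) (\<lambda>i. y (vertex_enum G i))) $ i
      = (\<mu> \<cdot>\<^sub>v vec (card (pverts G)) (\<lambda>i. y (vertex_enum G i))) $ i"
    using i assms(2) sum_vertex_enum[OF assms(1), of "\<lambda>w. adj G (vertex_enum G i) w * y w"] by simp
qed (simp add: adjacency_matrix_def)

lemma eigenfunction_in_adjacency_eigenvalues:
  assumes "finite (pverts G)"
    and "\<And>v. v \<in> pverts G \<Longrightarrow> (\<Sum>w\<in>pverts G. adj G v w * y w) = \<mu> * y v"
    and "\<exists>v\<in>pverts G. y v \<noteq> 0"
  shows "\<mu> \<in># adjacency_eigenvalues G"
proof -
  obtain i where i: "i < card (pverts G)" "y (vertex_enum G i) \<noteq> 0"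
  proof -
    obtain v where "v \<in> pverts G" "y v \<noteq> 0" using assms(3) by blast
    moreover from this have "v \<in> vertex_enum G ` {..<card (pverts G)}"
      using bij_betw_vertex_enum[OF assms(1)] by (simp add: bij_betw_def)
    ultimately show ?thesis using that by blast
  qed
  have "vec (card (pverts G)) (\<lambda>i. y (vertex_enum G i)) \<noteq> 0\<^sub>v (card (pverts G))"
    using i by (metis index_vec index_zero_vec(1))
  then have "eigenvalue (adjacency_matrix G) \<mu>"
    unfolding eigenvalue_def eigenvector_def
    using adjacency_matrix_eigenfunction[OF assms(1,2)]
    by (intro exI[of _ "vec (card (pverts G)) (\<lambda>i. y (vertex_enum G i))"])
      (auto simp: adjacency_matrix_def)
  then show ?thesis by (simp add: in_adjacency_eigenvalues_iff)
qed

text \<open>Together with the constant eigenfunction this identifies the largest eigenvalue of a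
  nonempty regular graph as its degree.\<close>

lemma adjacency_eigenvalue_le_degree:
  assumes fin: "finite (pverts G)"
    and row: "\<And>v. v \<in> pverts G \<Longrightarrow> (\<Sum>w\<in>pverts G. adj G v w) = D"
    and \<mu>: "\<mu> \<in># adjacency_eigenvalues G"
  shows "\<bar>\<mu>\<bar> \<le> D"
proof -
  let ?n = "card (pverts G)"
  have dim: "dim_row (adjacency_matrix G) = ?n" by (simp add: adjacency_matrix_def)
  obtain v where v: "v \<in> carrier_vec ?n" "v \<noteq> 0\<^sub>v ?n" "adjacency_matrix G *\<^sub>v v = \<mu> \<cdot>\<^sub>v v"
    using \<mu> by (auto simp: in_adjacency_eigenvalues_iff eigenvalue_def eigenvector_def dim)
  show ?thesis
  proof (rule abs_eigenvalue_le_row_sum[of "{..<?n}" "\<lambda>i j. adj G (vertex_enum G i) (vertex_enum G j)" D "\<lambda>i. v $ i"])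
    show "(\<Sum>j<?n. adj G (vertex_enum G i) (vertex_enum G j)) = D" if "i \<in> {..<?n}" for i
      using that row bij_betw_vertex_enum[OF fin] sum_vertex_enum[OF fin, of "adj G (vertex_enum G i)"]
      by (auto simp: bij_betw_def)
    show "(\<Sum>j<?n. adj G (vertex_enum G i) (vertex_enum G j) * v $ j) = \<mu> * v $ i"
      if "i \<in> {..<?n}" for i
      using that v adjacency_matrix_mult_vec[OF v(1), of i] by simp
    show "\<exists>i\<in>{..<?n}. v $ i \<noteq> 0"
      using v(1,2) by (metis carrier_vecD eq_vecI index_zero_vec lessThan_iff)
  qed (auto simp: adj_def)
qed

section \<open>Norm bounds for the centred adjacency matrix\<close>

context
  fixes G :: "'a pair_pre_digraph" and n d :: nat and l :: real
  assumes ndl: "ndl_graph n d l G"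
begin

lemma ndl_finite: "finite (pverts G)"
  using ndl by (simp add: ndl_graph_def pair_graph_def pair_digraph_def pair_fin_digraph.pair_finite_verts)

lemma ndl_card: "card (pverts G) = n"
  using ndl by (simp add: ndl_graph_def)

lemma ndl_adj_sym: "adj G v w = adj G w v"
proof -
  interpret pair_graph G using ndl by (simp add: ndl_graph_def)
  show ?thesis using arcs_symmetric by (auto simp: adj_def)
qed

lemma ndl_row_sum:
  assumes "v \<in> pverts G"
  shows "(\<Sum>w\<in>pverts G. adj G v w) = real d"
proof -
  interpret pair_graph G using ndl by (simp add: ndl_graph_def)
  have "(\<Sum>w\<in>pverts G. adj G v w) = real (card (pverts G \<inter> {w. v \<rightarrow>\<^bsub>G\<^esub> w}))"
    using ndl_finite by (simp add: adj_def sum_of_bool_eq)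
  also have "card (pverts G \<inter> {w. v \<rightarrow>\<^bsub>G\<^esub> w}) = card (Pair v ` (pverts G \<inter> {w. v \<rightarrow>\<^bsub>G\<^esub> w}))"
    by (simp add: card_image inj_on_def)
  also have "Pair v ` (pverts G \<inter> {w. v \<rightarrow>\<^bsub>G\<^esub> w}) = out_arcs G v"
    using in_arcsD2 by (auto simp: out_arcs_def)
  also have "card (out_arcs G v) = d"
    using ndl assms by (simp add: ndl_graph_def out_degree_def)
  finally show ?thesis .
qed

text \<open>The only danger is that \<open>\<mu>\<close> is the exempted largest eigenvalue. Then
  \<open>\<mu> = d\<close> has two independent eigenfunctions, \<open>y\<close> and the constant 1,
  so it occurs at least twice and one copy survives the removal.\<close>

lemma ndl_mean_zero_eigenvalue_le:
  assumes mean: "(\<Sum>v\<in>pverts G. y v) = 0" and nz: "\<exists>v\<in>pverts G. y v \<noteq> 0"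
    and ev: "\<And>v. v \<in> pverts G \<Longrightarrow> (\<Sum>w\<in>pverts G. adj G v w * y w) = \<mu> * y v"
  shows "\<bar>\<mu>\<bar> \<le> l"
proof -
  let ?E = "adjacency_eigenvalues G"
  have "\<mu> \<in># ?E"
    by (rule eigenfunction_in_adjacency_eigenvalues[OF ndl_finite ev nz])
  have "\<mu> \<in># ?E - {#Max (set_mset ?E)#}"
  proof (cases "\<mu> = Max (set_mset ?E)")
    case False
    then show ?thesis using \<open>\<mu> \<in># ?E\<close> by (simp add: in_diff_count)
  next
    case True
    have const: "(\<Sum>w\<in>pverts G. adj G v w * 1) = real d * 1" if "v \<in> pverts G" for v
      using ndl_row_sum[OF that] by simp
    have "real d \<in># ?E"
      using nz by (intro eigenfunction_in_adjacency_eigenvalues[OF ndl_finite const]) auto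
    then have "real d \<le> \<mu>" using True by simp
    moreover have "\<mu> \<le> real d"
      using adjacency_eigenvalue_le_degree[OF ndl_finite ndl_row_sum \<open>\<mu> \<in># ?E\<close>] by simp
    ultimately have \<mu>: "\<mu> = real d" by simp
    \<comment> \<open>A nonzero function with mean zero is not constant. Two indices with distinct
      values give a nonzero 2 by 2 minor of the pair \<open>1\<close>, \<open>y\<close>.\<close>
    obtain i j where ij: "i < n" "j < n" "y (vertex_enum G i) \<noteq> y (vertex_enum G j)"
    proof (rule ccontr)
      assume "\<not> thesis"
      then have eq: "y (vertex_enum G i) = y (vertex_enum G j)" if "i < n" "j < n" for i j
        using that \<open>\<And>j i. \<lbrakk>i < n; j < n; y (vertex_enum G i) \<noteq> y (vertex_enum G j)\<rbrakk> \<Longrightarrow> thesis\<close> by blast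
      have img: "pverts G = vertex_enum G ` {..<n}"
        using bij_betw_vertex_enum[OF ndl_finite] ndl_card by (simp add: bij_betw_def)
      obtain v where v: "v \<in> pverts G" "y v \<noteq> 0" using nz by blast
      then have "y w = y v" if "w \<in> pverts G" for w
        using that eq unfolding img by blast
      then have "(\<Sum>w\<in>pverts G. y w) = (\<Sum>w\<in>pverts G. y v)"
        by (intro sum.cong) auto
      also have "\<dots> \<noteq> 0" using v ndl_finite by auto
      finally show False using mean by simp
    qed
    have carrier: "adjacency_matrix G \<in> carrier_mat n n"
      by (simp add: adjacency_matrix_def ndl_card)
    have "[:- real d, 1:] ^ 2 dvd char_poly (adjacency_matrix G)"
      using adjacency_matrix_eigenfunction[OF ndl_finite const]
        adjacency_matrix_eigenfunction[OF ndl_finite ev] ij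
      by (intro char_poly_double_root[OF carrier, of "vec n (\<lambda>_. 1)" _
            "vec n (\<lambda>i. y (vertex_enum G i))" i j]) (auto simp: ndl_card \<mu>)
    moreover have nz: "char_poly (adjacency_matrix G) \<noteq> 0"
      using degree_monic_char_poly[OF carrier] by force
    ultimately have "2 \<le> order (real d) (char_poly (adjacency_matrix G))"
      by (simp add: order_divides)
    then have "2 \<le> count ?E \<mu>"
      using nz by (simp add: adjacency_eigenvalues_def \<mu>)
    then show ?thesis by (simp add: in_diff_count flip: True)
  qed
  then show ?thesis using ndl by (simp add: ndl_graph_def)
qed

lemma ndl_mean_zero_norm_le:
  assumes "(\<Sum>v\<in>pverts G. x v) = 0"
  shows "(\<Sum>v\<in>pverts G. (\<Sum>w\<in>pverts G. adj G v w * x w)\<^sup>2) \<le> l\<^sup>2 * (\<Sum>v\<in>pverts G. (x v)\<^sup>2)"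
\<comment> \<open>The zero function is separated because the extremal eigenvector is only available
  once some nonzero mean-zero function exists.\<close>
proof (cases "\<exists>v\<in>pverts G. x v \<noteq> 0")
  case False
  then show ?thesis by simp
next
  case True
  then obtain v where v: "v \<in> pverts G" "x v \<noteq> 0" by blast
  obtain \<mu> y where y: "(\<Sum>v\<in>pverts G. y v) = 0" "\<exists>v\<in>pverts G. y v \<noteq> 0"
      "\<forall>v\<in>pverts G. (\<Sum>w\<in>pverts G. adj G v w * y w) = \<mu> * y v"
    and le: "(\<Sum>v\<in>pverts G. (\<Sum>w\<in>pverts G. adj G v w * x w)\<^sup>2) \<le> \<mu>\<^sup>2 * (\<Sum>v\<in>pverts G. (x v)\<^sup>2)"
    by (rule extremal_mean_zero_eigenvector[OF ndl_finite ndl_adj_sym ndl_row_sum assms v])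
  have "\<bar>\<mu>\<bar> \<le> l" using y by (intro ndl_mean_zero_eigenvalue_le[of y]) auto
  then have "\<mu>\<^sup>2 \<le> l\<^sup>2" by (metis abs_ge_zero power2_abs power_mono)
  then have "\<mu>\<^sup>2 * (\<Sum>v\<in>pverts G. (x v)\<^sup>2) \<le> l\<^sup>2 * (\<Sum>v\<in>pverts G. (x v)\<^sup>2)"
    by (intro mult_right_mono sum_nonneg) auto
  with le show ?thesis by linarith
qed

text \<open>The centred matrix annihilates constants and agrees with the adjacency matrix on
  mean-zero functions. Subtracting the mean \<open>c\<close> reduces to that case, and it lowers the
  squared norm by \<open>c\<^sup>2 * n\<close>.\<close>

lemma ndl_centred_norm_le:
  "(\<Sum>v\<in>pverts G. (\<Sum>w\<in>pverts G. (adj G v w - real d / real n) * x w)\<^sup>2)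
    \<le> l\<^sup>2 * (\<Sum>v\<in>pverts G. (x v)\<^sup>2)"
proof (cases "n = 0")
  case True
  then show ?thesis using ndl_card ndl_finite by simp
next
  case False
  define V where "V = pverts G"
  define c where "c = (\<Sum>v\<in>V. x v) / real n"
  define x' where "x' v = x v - c" for v
  have card: "real (card V) = real n" by (simp add: V_def ndl_card)
  have cn: "(\<Sum>v\<in>V. x v) = c * real n" using False by (simp add: c_def)
  have mean: "(\<Sum>v\<in>V. x' v) = 0"
    using cn card by (simp add: x'_def sum_subtractf)
  have "(\<Sum>w\<in>V. (adj G v w - real d / real n) * x w) = (\<Sum>w\<in>V. adj G v w * x' w)" if "v \<in> V" for v
  proof -
    have "(\<Sum>w\<in>V. (adj G v w - real d / real n) * x w)
        = (\<Sum>w\<in>V. adj G v w * x w) - real d / real n * (\<Sum>w\<in>V. x w)"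
      by (simp add: left_diff_distrib sum_subtractf sum_distrib_left)
    also have "\<dots> = (\<Sum>w\<in>V. adj G v w * x w) - (\<Sum>w\<in>V. adj G v w) * c"
      using ndl_row_sum that False by (simp add: V_def[symmetric] cn)
    also have "\<dots> = (\<Sum>w\<in>V. adj G v w * x' w)"
      by (simp add: x'_def right_diff_distrib sum_subtractf sum_distrib_right)
    finally show ?thesis .
  qed
  then have "(\<Sum>v\<in>V. (\<Sum>w\<in>V. (adj G v w - real d / real n) * x w)\<^sup>2)
      = (\<Sum>v\<in>V. (\<Sum>w\<in>V. adj G v w * x' w)\<^sup>2)" by simp
  also have "\<dots> \<le> l\<^sup>2 * (\<Sum>v\<in>V. (x' v)\<^sup>2)"
    using mean unfolding V_def by (rule ndl_mean_zero_norm_le)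
  also have "\<dots> \<le> l\<^sup>2 * (\<Sum>v\<in>V. (x v)\<^sup>2)"
  proof (rule mult_left_mono)
    have "(\<Sum>v\<in>V. (x' v)\<^sup>2) = (\<Sum>v\<in>V. (x v)\<^sup>2 - (2 * c * x v - c\<^sup>2))"
      by (simp add: x'_def power2_diff algebra_simps)
    also have "\<dots> = (\<Sum>v\<in>V. (x v)\<^sup>2) - (2 * c * (\<Sum>v\<in>V. x v) - c\<^sup>2 * real n)"
      by (simp add: sum_subtractf card sum_distrib_left)
    also have "\<dots> = (\<Sum>v\<in>V. (x v)\<^sup>2) - c\<^sup>2 * real n"
      by (simp add: cn power2_eq_square)
    finally show "(\<Sum>v\<in>V. (x' v)\<^sup>2) \<le> (\<Sum>v\<in>V. (x v)\<^sup>2)" by simp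
  qed simp
  finally show ?thesis unfolding V_def .
qed

text \<open>Passing to a principal submatrix cannot increase the norm: extend \<open>x\<close> by
  zero and discard the rows outside \<open>W\<close>.\<close>

lemma ndl_centred_norm_le_subset:
  assumes W: "W \<subseteq> pverts G"
  shows "(\<Sum>v\<in>W. (\<Sum>w\<in>W. (adj G v w - real d / real n) * x w)\<^sup>2) \<le> l\<^sup>2 * (\<Sum>w\<in>W. (x w)\<^sup>2)"
proof -
  let ?x = "\<lambda>w. if w \<in> W then x w else 0"
  have restrict: "(\<Sum>w\<in>pverts G. f w * ?x w) = (\<Sum>w\<in>W. f w * x w)" for f
    using W ndl_finite by (intro sum.mono_neutral_cong_right) auto
  have "(\<Sum>v\<in>W. (\<Sum>w\<in>W. (adj G v w - real d / real n) * x w)\<^sup>2)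
      \<le> (\<Sum>v\<in>pverts G. (\<Sum>w\<in>W. (adj G v w - real d / real n) * x w)\<^sup>2)"
    using W ndl_finite by (intro sum_mono2) auto
  also have "\<dots> \<le> l\<^sup>2 * (\<Sum>v\<in>pverts G. (?x v)\<^sup>2)"
    using ndl_centred_norm_le[of ?x] unfolding restrict .
  also have "(\<Sum>v\<in>pverts G. (?x v)\<^sup>2) = (\<Sum>v\<in>W. (x v)\<^sup>2)"
    using W ndl_finite by (intro sum.mono_neutral_cong_right) auto
  finally show ?thesis .
qed

section \<open>Counting via the common edge of two 4-cycles, and the final bound\<close>

text \<open>Fix the edge from \<open>z\<close> to \<open>t\<close>, where \<open>t\<close> stands
  for the vertex \<open>u'\<close>. The pairs \<open>(u, v)\<close> and \<open>(y, x)\<close> then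
  range independently over the inner vertices of walks of length three from \<open>z\<close> to
  \<open>t\<close>; for \<open>(y, x)\<close> the arcs are reversed by symmetry. The map
  \<open>\<phi>\<close> undoes this regrouping.\<close>

lemma H4_eq_sum_edges:
  assumes W: "W \<subseteq> pverts G"
  shows "real (H4 G W) = (\<Sum>z\<in>W. \<Sum>t\<in>W. adj G z t * (\<Sum>u\<in>W. \<Sum>v\<in>W. adj G z u * adj G u v * adj G v t)\<^sup>2)"
proof -
  have fin: "finite W" using W ndl_finite by (rule finite_subset)
  define P where "P z t = {(u, v). u \<in> W \<and> v \<in> W \<and> z \<rightarrow>\<^bsub>G\<^esub> u \<and> u \<rightarrow>\<^bsub>G\<^esub> v \<and> v \<rightarrow>\<^bsub>G\<^esub> t}" for z t
  define E where "E = {(z, t). z \<in> W \<and> t \<in> W \<and> z \<rightarrow>\<^bsub>G\<^esub> t}"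
  define \<phi> :: "('a \<times> 'a) \<times> ('a \<times> 'a) \<times> ('a \<times> 'a) \<Rightarrow> 'a \<times> 'a \<times> 'a \<times> 'a \<times> 'a \<times> 'a"
    where "\<phi> = (\<lambda>((z, t), (u, v), (y, x)). (y, z, u, v, t, x))"
  have sym: "(v \<rightarrow>\<^bsub>G\<^esub> w) = (w \<rightarrow>\<^bsub>G\<^esub> v)" for v w
    using ndl_adj_sym[of v w] by (simp add: adj_def of_bool_def split: if_splits)
  have finP: "finite (P z t)" for z t
    by (rule finite_subset[of _ "W \<times> W"]) (use fin in \<open>auto simp: P_def\<close>)
  have cardP: "real (card (P z t)) = (\<Sum>u\<in>W. \<Sum>v\<in>W. adj G z u * adj G u v * adj G v t)" for z t
  proof -
    have "(\<Sum>u\<in>W. \<Sum>v\<in>W. adj G z u * adj G u v * adj G v t)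
        = (\<Sum>p\<in>W \<times> W. of_bool (z \<rightarrow>\<^bsub>G\<^esub> fst p \<and> fst p \<rightarrow>\<^bsub>G\<^esub> snd p \<and> snd p \<rightarrow>\<^bsub>G\<^esub> t))"
      by (simp add: sum.cartesian_product adj_def split_beta of_bool_conj mult.assoc)
    also have "\<dots> = real (card (W \<times> W \<inter> {p. z \<rightarrow>\<^bsub>G\<^esub> fst p \<and> fst p \<rightarrow>\<^bsub>G\<^esub> snd p \<and> snd p \<rightarrow>\<^bsub>G\<^esub> t}))"
      by (rule sum_of_bool_eq) (use fin in auto)
    also have "W \<times> W \<inter> {p. z \<rightarrow>\<^bsub>G\<^esub> fst p \<and> fst p \<rightarrow>\<^bsub>G\<^esub> snd p \<and> snd p \<rightarrow>\<^bsub>G\<^esub> t} = P z t"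
      by (auto simp: P_def)
    finally show ?thesis by simp
  qed
  have "{(y, z, u, v, u', x).
     y \<in> W \<and> z \<in> W \<and> u \<in> W \<and> v \<in> W \<and> u' \<in> W \<and> x \<in> W \<and>
     y \<rightarrow>\<^bsub>G\<^esub> z \<and> z \<rightarrow>\<^bsub>G\<^esub> u \<and> u \<rightarrow>\<^bsub>G\<^esub> v \<and> v \<rightarrow>\<^bsub>G\<^esub> u' \<and> u' \<rightarrow>\<^bsub>G\<^esub> x \<and> x \<rightarrow>\<^bsub>G\<^esub> y \<and> z \<rightarrow>\<^bsub>G\<^esub> u'}
     = \<phi> ` (SIGMA e:E. P (fst e) (snd e) \<times> P (fst e) (snd e))" (is "?S = \<phi> ` ?T")
  proof (intro equalityI subsetI)
    fix p assume "p \<in> ?S"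
    then obtain y z u v t x where p: "p = (y, z, u, v, t, x)"
      and "y \<in> W" "z \<in> W" "u \<in> W" "v \<in> W" "t \<in> W" "x \<in> W"
        "y \<rightarrow>\<^bsub>G\<^esub> z" "z \<rightarrow>\<^bsub>G\<^esub> u" "u \<rightarrow>\<^bsub>G\<^esub> v" "v \<rightarrow>\<^bsub>G\<^esub> t" "t \<rightarrow>\<^bsub>G\<^esub> x" "x \<rightarrow>\<^bsub>G\<^esub> y" "z \<rightarrow>\<^bsub>G\<^esub> t"
      by blast
    then have "((z, t), (u, v), (y, x)) \<in> ?T"
      using sym[of y z] sym[of t x] sym[of x y] by (simp add: E_def P_def)
    moreover have "p = \<phi> ((z, t), (u, v), (y, x))" by (simp add: \<phi>_def p)
    ultimately show "p \<in> \<phi> ` ?T" by (rule rev_image_eqI)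
  next
    fix p assume "p \<in> \<phi> ` ?T"
    then obtain y z u v t x where "((z, t), (u, v), (y, x)) \<in> ?T" and p: "p = (y, z, u, v, t, x)"
      by (auto simp: \<phi>_def)
    then show "p \<in> ?S"
      using sym[of y z] sym[of t x] sym[of x y] by (simp add: E_def P_def)
  qed
  then have "H4 G W = card (\<phi> ` ?T)" by (simp add: H4_def)
  also have "\<dots> = card ?T" by (rule card_image) (auto simp: inj_on_def \<phi>_def)
  also have "real \<dots> = (\<Sum>e\<in>E. (real (card (P (fst e) (snd e))))\<^sup>2)"
  proof -
    have "finite E" by (rule finite_subset[of _ "W \<times> W"]) (use fin in \<open>auto simp: E_def\<close>)
    then have "card ?T = (\<Sum>e\<in>E. card (P (fst e) (snd e) \<times> P (fst e) (snd e)))"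
      using finP by (intro card_SigmaI) auto
    then show ?thesis by (simp add: card_cartesian_product power2_eq_square)
  qed
  also have "\<dots> = (\<Sum>e\<in>W \<times> W. adj G (fst e) (snd e) * (real (card (P (fst e) (snd e))))\<^sup>2)"
    using fin by (intro sum.mono_neutral_cong_left) (auto simp: E_def adj_def)
  also have "\<dots> = (\<Sum>z\<in>W. \<Sum>t\<in>W. adj G z t * (real (card (P z t)))\<^sup>2)"
    by (simp add: sum.cartesian_product split_beta)
  finally show ?thesis unfolding cardP .
qed

lemma ndl_degree_le: "pverts G \<noteq> {} \<Longrightarrow> d \<le> n"
proof -
  assume "pverts G \<noteq> {}"
  then obtain v where "v \<in> pverts G" by blast
  then have "real d = (\<Sum>w\<in>pverts G. adj G v w)" using ndl_row_sum by simp
  also have "\<dots> \<le> (\<Sum>w\<in>pverts G. 1)" by (intro sum_mono) (simp add: adj_def)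
  also have "\<dots> = real n" by (simp add: ndl_card)
  finally show ?thesis by simp
qed

lemma ndl_H4_le:
  assumes W: "W \<subseteq> pverts G" and K: "1 \<le> K"
    and l: "l\<^sup>2 * (real n / real d) ^ 3 \<le> K * (real (card W))\<^sup>2"
  shows "real (H4 G W) \<le> 88 * K ^ 3 * (real (card W) ^ 6 * real d ^ 7 / real n ^ 7)"
\<comment> \<open>For \<open>d = 0\<close> the quotient \<open>n / d\<close> is 0 by convention, so
  the hypothesis says nothing about \<open>l\<close>; but then there are no edges and the count is
  0.\<close>
proof (cases "W = {} \<or> d = 0")
  case True
  have "adj G z t = 0" if "z \<in> W" "t \<in> W" for z t
  proof -
    have "d = 0" using True that by auto
    then have "(\<Sum>w\<in>pverts G. adj G z w) = 0" using ndl_row_sum W that by auto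
    then show ?thesis
      using W that ndl_finite by (subst (asm) sum_nonneg_eq_0_iff) (auto simp: adj_def)
  qed
  then have "real (H4 G W) = 0" unfolding H4_eq_sum_edges[OF W] by simp
  then show ?thesis using K by simp
next
  case False
  then have d: "0 < d" "d \<le> n" using ndl_degree_le W by auto
  have "l\<^sup>2 \<le> K * (real d / real n) ^ 3 * (real (card W))\<^sup>2"
    using l d by (simp add: field_simps)
  then have "real (H4 G W) \<le> 88 * K ^ 3 * ((real d / real n) ^ 7 * real (card W) ^ 6)"
    unfolding H4_eq_sum_edges[OF W] using K d
    by (intro sum_edges_square_cube_le[OF _ ndl_adj_sym _ _ refl
          ndl_centred_norm_le_subset[OF W]]) (auto simp: adj_def)
  then show ?thesis by (simp add: power_divide mult.commute)
qed

end

theorem theorem3p5: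
  fixes F :: "'i filter"
    and G :: "'i \<Rightarrow> 'a pair_pre_digraph"
    and n d :: "'i \<Rightarrow> nat"
    and l :: "'i \<Rightarrow> real"
    and U :: "'i \<Rightarrow> 'a set"
  assumes "\<And>i. ndl_graph (n i) (d i) (l i) (G i)"
    and "filterlim n at_top F"
    and "\<And>i. U i \<subseteq> pverts (G i)"
    and "(\<lambda>i. real (card (U i))) \<in> \<Omega>[F](\<lambda>i. l i * (real (n i) / real (d i)) powr (3 / 2))"
  shows "\<exists>U' :: 'i \<Rightarrow> 'a set.
      (\<forall>i. U' i \<subseteq> U i) \<and>
      (\<exists>\<epsilon> :: 'i \<Rightarrow> real. \<epsilon> \<in> o[F](\<lambda>_. 1) \<and>
         (\<forall>i. real (card (U' i)) = (1 - \<epsilon> i) * real (card (U i)))) \<and>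
      (\<lambda>i. real (H4 (G i) (U' i))) \<in>
        O[F](\<lambda>i. real (card (U' i)) ^ 6 * real (d i) ^ 7 / real (n i) ^ 7)"
proof (intro exI[of _ U] conjI allI order_refl exI[of _ "\<lambda>_. 0"])
  obtain c where c: "c > 0" and ev: "\<forall>\<^sub>F i in F.
      c * norm (l i * (real (n i) / real (d i)) powr (3 / 2)) \<le> norm (real (card (U i)))"
    using assms(4) by (rule landau_omega.bigE)
  \<comment> \<open>Squaring the lower bound with constant \<open>c\<close> gives the factor
    \<open>1 / c\<^sup>2\<close>; the maximum with 1 secures \<open>1 \<le> K\<close>.\<close>
  define K where "K = max 1 (1 / c\<^sup>2)"
  show "(\<lambda>i. real (H4 (G i) (U i))) \<in>
      O[F](\<lambda>i. real (card (U i)) ^ 6 * real (d i) ^ 7 / real (n i) ^ 7)"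
  proof (rule bigoI)
    show "\<forall>\<^sub>F i in F. norm (real (H4 (G i) (U i)))
        \<le> 88 * K ^ 3 * norm (real (card (U i)) ^ 6 * real (d i) ^ 7 / real (n i) ^ 7)"
      using ev
    proof eventually_elim
      case (elim i)
      let ?r = "real (n i) / real (d i)"
      \<comment> \<open>This includes \<open>?r = 0\<close>, where both sides are 0.\<close>
      have powr: "(?r powr (3 / 2))\<^sup>2 = ?r ^ 3"
        by (simp add: power2_eq_square flip: powr_add)
      have "(c * norm (l i * ?r powr (3 / 2)))\<^sup>2 \<le> (norm (real (card (U i))))\<^sup>2"
        using elim c by (intro power_mono) auto
      then have "c\<^sup>2 * ((l i)\<^sup>2 * ?r ^ 3) \<le> (real (card (U i)))\<^sup>2"
        unfolding powr[symmetric] by (simp add: power_mult_distrib abs_mult)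
      then have "(l i)\<^sup>2 * ?r ^ 3 \<le> 1 / c\<^sup>2 * (real (card (U i)))\<^sup>2"
        using c by (simp add: pos_le_divide_eq mult.commute)
      also have "\<dots> \<le> K * (real (card (U i)))\<^sup>2"
        by (intro mult_right_mono) (auto simp: K_def)
      finally have "real (H4 (G i) (U i))
          \<le> 88 * K ^ 3 * (real (card (U i)) ^ 6 * real (d i) ^ 7 / real (n i) ^ 7)"
        by (intro ndl_H4_le[OF assms(1) assms(3)]) (auto simp: K_def)
      then show ?case by simp
    qed
  qed
qed simp_all

end
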